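(* For every integer $k \ge 1$, the Bernoulli number $B_{2k}$ is given by $$B_{2k} = \frac{4 \cdot (k+1)!}{(2k+2)! \, 2^{k}} \begin{vmatrix} \binom{3}{2} & 0 & 0 & \cdots & 0 & 1 \\ \binom{5}{2} & \binom{5}{4} & 0 & \cdots & 0 & 2 \\ \binom{7}{2} & \binom{7}{4} & \binom{7}{6} & \cdots & 0 & 3 \\ \vdots & \vdots & \vdots & \ddots & \vdots & \vdots \\ \binom{2k-1}{2} & \binom{2k-1}{4} & \binom{2k-1}{6} & \cdots & \binom{2k-1}{2k-2} & k-1 \\ \binom{2k+1}{2} & \binom{2k+1}{4} & \binom{2k+1}{6} & \cdots & \binom{2k+1}{2k-2} & k \end{vmatrix}.$$ That is, the determinant is that of the $k\times k$ matrix whose $(i,j)$ entry is $\binom{2i+1}{2j}$ for $1 \le i \le k$, $1 \le j \le k-1$ (which is $0$ when $j>i$), and whose $(i,k)$ entry is $i$ for $1 \le i \le k$.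
   Context: The Bernoulli numbers $B_m$ are the usual ones, defined by $\frac{t}{e^t-1} = \sum_{m\ge 0} B_m \frac{t^m}{m!}$ (so $B_2 = \frac16$, $B_4 = -\frac1{30}$, etc.). *)

theory Defs
  imports
    "HOL-Computational_Algebra.Formal_Power_Series"
    "Jordan_Normal_Form.Determinant"
begin

definition bernoulli :: "nat \<Rightarrow> real" where
  "bernoulli m = fact m * fps_nth (fps_X / (fps_exp 1 - 1)) m"

(* JNF matrices are 0-indexed: position (i, j) here is position (i + 1, j + 1) of the k x k matrix. *)
definition binom_mat :: "nat \<Rightarrow> real mat" where
  "binom_mat k = mat k k (\<lambda>(i, j).
     if Suc j = k then real (Suc i) else real ((2 * Suc i + 1) choose (2 * Suc j)))"

end

theory Submission
  imports Defs
begin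

text \<open>
  The formula is Cramer's rule. Let \<open>T\<close> be the lower triangular matrix with entries
  \<open>(2i+1 choose 2j)\<close>, \<open>1 \<le> i, j \<le> k\<close>. The vector \<open>x\<close> with \<open>x_j = 2^(2j-1) B_(2j)\<close> solves
  \<open>T x = (1, 2, \<dots>, k)\<close>, and the matrix of the theorem is \<open>T\<close> with its last column replaced by
  this right-hand side, so its determinant is \<open>2^(2k-1) B_(2k) det T\<close>. Finally
  \<open>det T = 3 \<sqdot> 5 \<cdots> (2k+1)\<close>, the product of the diagonal entries.

  The linear system (\<open>even_bernoulli_system\<close>) is not the usual recurrence for Bernoulli numbers
  with right-hand side \<open>i - 1/2\<close>, but comes from the evenness of
  \<open>2t e^t / (e^(2t) - 1) = t / sinh t\<close>: its odd coefficients vanish, which says that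
  \<open>(\<Sum>j\<le>n. (n choose j) 2^j B_j) = 0\<close> for odd \<open>n\<close>. The terms \<open>j = 0\<close> and \<open>j = 1\<close>
  contribute \<open>1 - n\<close>, and the other odd terms vanish because \<open>t / (e^t - 1) + t / 2\<close> is even.
\<close>

section \<open>Bernoulli numbers and the parity of generating functions\<close>

definition bernoulli_gf :: "real fps" where
  "bernoulli_gf = fps_X / (fps_exp 1 - 1)"

lemma bernoulli_gf_nth: "fps_nth bernoulli_gf m = bernoulli m / fact m"
  by (simp add: bernoulli_gf_def bernoulli_def)

lemma fps_exp_minus_1_nonzero:
  assumes "c \<noteq> (0 :: real)"
  shows "fps_exp c - 1 \<noteq> 0"
proof
  assume "fps_exp c - 1 = 0"
  then have "fps_nth (fps_exp c - 1) 1 = 0" by simp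
  with assms show False by simp
qed

lemma bernoulli_gf_times: "bernoulli_gf * (fps_exp 1 - 1) = fps_X"
proof -
  have "subdegree (fps_exp 1 - 1 :: real fps) = 1"
    by (rule subdegreeI) auto
  then have "fps_exp 1 - 1 dvd (fps_X :: real fps)"
    using fps_exp_minus_1_nonzero[of 1] by (subst fps_dvd_iff) auto
  then show ?thesis
    by (simp add: bernoulli_gf_def)
qed

definition bernoulli_gf_scaled :: "real \<Rightarrow> real fps" where
  "bernoulli_gf_scaled c = Abs_fps (\<lambda>n. c ^ n * fps_nth bernoulli_gf n)"

lemma bernoulli_gf_scaled_times:
  "bernoulli_gf_scaled c * (fps_exp c - 1) = fps_const c * fps_X"
proof -
  let ?l = "fps_const c * fps_X :: real fps"
  have "(bernoulli_gf * (fps_exp 1 - 1)) oo ?l = fps_X oo ?l"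
    by (simp add: bernoulli_gf_times)
  moreover have "(bernoulli_gf * (fps_exp 1 - 1)) oo ?l =
      (bernoulli_gf oo ?l) * ((fps_exp 1 oo ?l) - (1 oo ?l))"
    by (simp add: fps_compose_mult_distrib fps_compose_sub_distrib)
  moreover have "fps_exp 1 oo ?l = fps_exp c"
    by (simp add: fps_compose_linear fps_eq_iff)
  moreover have "fps_X oo ?l = ?l"
    by (rule fps_X_fps_compose_startby0) simp
  moreover have "bernoulli_gf oo ?l = bernoulli_gf_scaled c"
    by (simp add: fps_compose_linear bernoulli_gf_scaled_def)
  ultimately show ?thesis
    by simp
qed

text \<open>
  Multiplying \<open>-t / (e^(-t) - 1)\<close> by \<open>e^t\<close> in numerator and denominator gives
  \<open>t e^t / (e^t - 1) = t + t / (e^t - 1)\<close>, so only the linear coefficient of \<open>t / (e^t - 1)\<close>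
  changes under \<open>t \<mapsto> -t\<close>.
\<close>

lemma bernoulli_gf_reflect: "bernoulli_gf_scaled (-1) = bernoulli_gf + fps_X"
proof -
  let ?E = "fps_exp 1 :: real fps"
  have inv: "fps_exp (-1) * ?E = 1"
    by (simp flip: fps_exp_add_mult)
  have "bernoulli_gf_scaled (-1) * (?E - 1)
      = - (bernoulli_gf_scaled (-1) * (fps_exp (-1) - 1) * ?E)"
    using inv by (simp add: algebra_simps)
  also have "\<dots> = fps_X * ?E"
    unfolding bernoulli_gf_scaled_times by (simp flip: fps_const_neg)
  also have "\<dots> = (bernoulli_gf + fps_X) * (?E - 1)"
    by (simp add: algebra_simps bernoulli_gf_times[unfolded right_diff_distrib] 
        flip: bernoulli_gf_times)
  finally show ?thesis
    using fps_exp_minus_1_nonzero[of 1] by simp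
qed

lemma bernoulli_reflect:
  "(-1) ^ n * bernoulli n = bernoulli n + (if n = 1 then 1 else 0)"
proof -
  have "fps_nth (bernoulli_gf_scaled (-1)) n = fps_nth (bernoulli_gf + fps_X) n"
    by (simp add: bernoulli_gf_reflect)
  then show ?thesis
    by (simp add: bernoulli_gf_scaled_def bernoulli_gf_nth field_simps fps_X_def split: if_splits)
qed

lemma bernoulli_1: "bernoulli 1 = -1/2"
  using bernoulli_reflect[of 1] by simp

lemma bernoulli_odd_eq_0:
  assumes "odd n" "n \<noteq> 1"
  shows "bernoulli n = 0"
  using bernoulli_reflect[of n] assms by simp

lemma bernoulli_0: "bernoulli 0 = 1"
proof -
  have "fps_nth (bernoulli_gf * (fps_exp 1 - 1)) 1 = 1"
    by (simp add: bernoulli_gf_times)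
  then show ?thesis
    by (simp add: bernoulli_gf_nth)
qed

text \<open>
  Both sides become the same odd series after multiplication by \<open>e^t - e^(-t)\<close>; this is the
  evenness of \<open>t / sinh t\<close>.
\<close>

lemma bernoulli_gf_scaled_even:
  "bernoulli_gf_scaled (-2) * fps_exp (-1) = bernoulli_gf_scaled 2 * fps_exp 1"
proof -
  let ?S = "fps_exp 1 - fps_exp (-1) :: real fps"
  have *: "fps_exp c * (fps_exp c - fps_exp (-c)) = fps_exp (2 * c) - 1" for c :: real
    by (simp add: right_diff_distrib flip: fps_exp_add_mult)
  have "bernoulli_gf_scaled (-2) * fps_exp (-1) * ?S
      = - (bernoulli_gf_scaled (-2) * (fps_exp (-1) * (fps_exp (-1) - fps_exp (- (-1)))))"
    by (simp add: algebra_simps)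
  also have "\<dots> = - (fps_const (-2) * fps_X)"
    unfolding * using bernoulli_gf_scaled_times[of "-2"] by simp
  also have "\<dots> = fps_const 2 * fps_X"
    by (simp flip: fps_const_neg)
  also have "\<dots> = bernoulli_gf_scaled 2 * (fps_exp 1 * ?S)"
    unfolding * using bernoulli_gf_scaled_times[of 2] by simp
  finally have "bernoulli_gf_scaled (-2) * fps_exp (-1) * ?S
      = bernoulli_gf_scaled 2 * fps_exp 1 * ?S"
    by (simp add: mult.assoc)
  moreover have "?S \<noteq> 0"
  proof
    assume "?S = 0"
    then have "fps_nth ?S 1 = 0" by simp
    then show False by simp
  qed
  ultimately show ?thesis
    by simp
qed

lemma bernoulli_binomial_sum_odd:
  assumes "odd n"
  shows "(\<Sum>j\<le>n. real (n choose j) * 2 ^ j * bernoulli j) = 0"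
proof -
  let ?c = "\<lambda>s. fps_nth (bernoulli_gf_scaled (s * 2) * fps_exp s) n"
  have coeff: "fact n * ?c s = s ^ n * (\<Sum>j\<le>n. real (n choose j) * 2 ^ j * bernoulli j)" for s
  proof -
    have "fact n * ?c s = (\<Sum>j\<le>n. fact n * ((s * 2) ^ j * (bernoulli j / fact j) *
        (s ^ (n - j) / fact (n - j))))"
      by (simp add: fps_mult_nth bernoulli_gf_scaled_def bernoulli_gf_nth sum_distrib_left
          atLeast0AtMost)
    also have "\<dots> = (\<Sum>j\<le>n. s ^ n * (real (n choose j) * 2 ^ j * bernoulli j))"
    proof (rule sum.cong)
      fix j assume "j \<in> {..n}"
      then have "j \<le> n" by simp
      then have "s ^ n = s ^ j * s ^ (n - j)"
        by (simp flip: power_add)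
      then show "fact n * ((s * 2) ^ j * (bernoulli j / fact j) * (s ^ (n - j) / fact (n - j)))
          = s ^ n * (real (n choose j) * 2 ^ j * bernoulli j)"
        using \<open>j \<le> n\<close> by (simp add: binomial_fact power_mult_distrib)
    qed simp
    finally show ?thesis
      by (simp add: sum_distrib_left)
  qed
  have "?c (-1) = ?c 1"
    using bernoulli_gf_scaled_even by simp
  then have "fact n * ?c (-1) = fact n * ?c 1"
    by simp
  then show ?thesis
    unfolding coeff using assms by simp
qed

section \<open>The linear system and Cramer's rule\<close>

lemma sum_atMost_odd_split:
  fixes f :: "nat \<Rightarrow> 'a :: comm_monoid_add"
  shows "(\<Sum>j\<le>2 * m + 1. f j) = f 0 + f 1 + (\<Sum>j<m. f (2 * Suc j) + f (2 * Suc j + 1))"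
  by (induction m) (simp_all add: add.assoc)

lemma even_bernoulli_system:
  "(\<Sum>j<m. real ((2 * m + 1) choose (2 * Suc j)) *
      (2 ^ (2 * j + 1) * bernoulli (2 * Suc j))) = real m"
proof -
  let ?f = "\<lambda>j. real ((2 * m + 1) choose j) * 2 ^ j * bernoulli j"
  have "0 = (\<Sum>j\<le>2 * m + 1. ?f j)"
    by (rule bernoulli_binomial_sum_odd[symmetric]) simp
  also have "\<dots> = ?f 0 + ?f 1 + (\<Sum>j<m. ?f (2 * Suc j) + ?f (2 * Suc j + 1))"
    by (rule sum_atMost_odd_split)
  also have "\<dots> = - 2 * real m + (\<Sum>j<m. ?f (2 * Suc j))"
    by (simp add: bernoulli_0 bernoulli_1[simplified] bernoulli_odd_eq_0 field_simps)
  also have "(\<Sum>j<m. ?f (2 * Suc j)) = 2 * (\<Sum>j<m. real ((2 * m + 1) choose (2 * Suc j)) *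
      (2 ^ (2 * j + 1) * bernoulli (2 * Suc j)))"
    by (simp add: sum_distrib_left mult_ac)
  finally show ?thesis
    by simp
qed

definition odd_binom_mat :: "nat \<Rightarrow> real mat" where
  "odd_binom_mat k = mat k k (\<lambda>(i, j). real ((2 * Suc i + 1) choose (2 * Suc j)))"

definition even_bernoulli_vec :: "nat \<Rightarrow> real vec" where
  "even_bernoulli_vec k = vec k (\<lambda>j. 2 ^ (2 * j + 1) * bernoulli (2 * Suc j))"

lemma odd_binom_mat_mult_even_bernoulli_vec:
  "odd_binom_mat k *\<^sub>v even_bernoulli_vec k = vec k (\<lambda>i. real (Suc i))"
proof (rule eq_vecI)
  fix i assume "i < dim_vec (vec k (\<lambda>i. real (Suc i)))"
  then have i: "i < k" by simp
  let ?g = "\<lambda>j. real ((2 * Suc i + 1) choose (2 * Suc j)) *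
      (2 ^ (2 * j + 1) * bernoulli (2 * Suc j))"
  have "(odd_binom_mat k *\<^sub>v even_bernoulli_vec k) $ i = (\<Sum>j<k. ?g j)"
    using i by (simp add: odd_binom_mat_def even_bernoulli_vec_def scalar_prod_def
        atLeast0LessThan del: binomial_Suc_Suc)
  also have "\<dots> = (\<Sum>j<Suc i. ?g j)"
    by (rule sum.mono_neutral_right) (use i in \<open>auto simp: binomial_eq_0 simp del: binomial_Suc_Suc\<close>)
  also have "\<dots> = real (Suc i)"
    by (rule even_bernoulli_system)
  finally show "(odd_binom_mat k *\<^sub>v even_bernoulli_vec k) $ i = vec k (\<lambda>i. real (Suc i)) $ i"
    using i by simp
qed (simp add: odd_binom_mat_def)

text \<open>
  The even factors of \<open>(2k+2)!\<close> contribute \<open>2^(k+1) (k+1)!\<close>; the odd ones remain as the product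
  that equals \<open>det T\<close>.
\<close>

lemma fact_even_double_factorial:
  "fact (2 * k + 2) = (2 ^ (k + 1) * fact (k + 1) * (\<Prod>i<k. real (2 * i + 3)) :: real)"
proof (induction k)
  case (Suc k)
  have "fact (2 * Suc k + 2) = (real (2 * k + 4) * real (2 * k + 3)) * (fact (2 * k + 2) :: real)"
    by (simp add: algebra_simps)
  also have "\<dots> = (2 * real (k + 2)) * real (2 * k + 3) *
      (2 ^ (k + 1) * fact (k + 1) * (\<Prod>i<k. real (2 * i + 3)))"
    unfolding Suc.IH by simp
  also have "\<dots> = (2 * 2 ^ (k + 1)) * (real (k + 2) * fact (k + 1)) *
      ((\<Prod>i<k. real (2 * i + 3)) * real (2 * k + 3))"
    by (simp only: mult_ac)
  also have "\<dots> = 2 ^ (Suc k + 1) * fact (Suc k + 1) * (\<Prod>i<Suc k. real (2 * i + 3))"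
    by simp
  finally show ?case .
qed simp

lemma det_odd_binom_mat: "det (odd_binom_mat k) = (\<Prod>i<k. real (2 * i + 3))"
proof -
  have "det (odd_binom_mat k) = prod_list (diag_mat (odd_binom_mat k))"
    by (rule det_lower_triangular[where n = k])
      (auto simp: odd_binom_mat_def binomial_eq_0 simp del: binomial_Suc_Suc)
  also have "\<dots> = (\<Prod>i<k. odd_binom_mat k $$ (i, i))"
    by (simp add: diag_mat_def prod.list_conv_set_nth atLeast0LessThan odd_binom_mat_def)
  also have "\<dots> = (\<Prod>i<k. real (2 * i + 3))"
  proof (rule prod.cong)
    fix i assume "i \<in> {..<k}"
    moreover have "(2 * Suc i + 1) choose (2 * Suc i) = 2 * i + 3"
      using binomial_Suc_n[of "2 * Suc i"] by (simp del: binomial_Suc_Suc)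
    ultimately show "odd_binom_mat k $$ (i, i) = real (2 * i + 3)"
      by (simp add: odd_binom_mat_def del: binomial_Suc_Suc)
  qed simp
  finally show ?thesis .
qed

lemma binom_mat_eq_replace_col:
  assumes "k \<ge> 1"
  shows "binom_mat k = replace_col (odd_binom_mat k) (vec k (\<lambda>i. real (Suc i))) (k - 1)"
  using assms
  by (intro eq_matI) (auto simp: binom_mat_def replace_col_def odd_binom_mat_def
      simp del: binomial_Suc_Suc)

theorem mainTheorem6:
  fixes k :: nat
  assumes "k \<ge> 1"
  shows "bernoulli (2 * k) =
    4 * fact (k + 1) / (fact (2 * k + 2) * 2 ^ k) * det (binom_mat k)"
proof -
  let ?D = "\<Prod>i<k. real (2 * i + 3)"
  have "det (binom_mat k) = even_bernoulli_vec k $ (k - 1) * det (odd_binom_mat k)"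
    unfolding binom_mat_eq_replace_col[OF assms] odd_binom_mat_mult_even_bernoulli_vec[symmetric]
    by (rule cramer_lemma_mat) (use assms in \<open>auto simp: odd_binom_mat_def even_bernoulli_vec_def\<close>)
  also have "even_bernoulli_vec k $ (k - 1) = 2 ^ (2 * (k - 1) + 1) * bernoulli (2 * k)"
    using assms by (cases k) (simp_all add: even_bernoulli_vec_def)
  finally have det: "det (binom_mat k) = 2 ^ (2 * (k - 1) + 1) * bernoulli (2 * k) * ?D"
    by (simp only: det_odd_binom_mat)
  have "?D \<noteq> 0"
    by simp
  have exponents: "(2 :: real) ^ (k + 1) * 2 ^ k = 4 * 2 ^ (2 * (k - 1) + 1)"
  proof -
    have "(2 :: real) ^ (k + 1) * 2 ^ k = 2 ^ (2 + (2 * (k - 1) + 1))"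
      unfolding power_add[symmetric] using assms by (intro arg_cong[where f = "power 2"]) simp
    also have "\<dots> = 2 ^ 2 * 2 ^ (2 * (k - 1) + 1)"
      by (rule power_add)
    finally show ?thesis
      by simp
  qed
  have "4 * fact (k + 1) / (fact (2 * k + 2) * 2 ^ k) * det (binom_mat k)
      = 4 * fact (k + 1) * (2 ^ (2 * (k - 1) + 1) * bernoulli (2 * k) * ?D) /
        ((2 ^ (k + 1) * 2 ^ k) * fact (k + 1) * ?D)"
    unfolding det fact_even_double_factorial by (simp only: times_divide_eq_left times_divide_eq_right mult_ac)
  also have "\<dots> = bernoulli (2 * k)"
    unfolding exponents using \<open>?D \<noteq> 0\<close> by (simp del: fact_Suc prod_zero_iff power_Suc)
  finally show ?thesis
    by (rule sym)
qed

end
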